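(* Let $n\ge2$, $N=2n+1$, $d=n(n-1)/2$. Suppose that $c_i\in\mathbb R$, $d_i\in\mathbb R^d$ ($1\le i\le N$) and $U_0\in\mathcal U$ satisfy $$c_j-c_i>\langle\eta_i^2(U_0),\,\eta_j^1(U_0)-\eta_i^1(U_0)\rangle+d_i\cdot J(\eta_j^1(U_0)-\eta_i^1(U_0))\qquad\text{for all }1\le i\ne j\le N.$$ Then there is $\epsilon_0>0$ such that for all $\epsilon\in(0,\epsilon_0)$ there exists a smooth convex function $G\colon\mathbb R^{2\times n}\times\mathbb R^d\to\mathbb R$ such that, with $\tilde\eta_i^1=(\eta_i^1(U_0),J(\eta_i^1(U_0)))$, for $i=1,\dots,N$, $$G(\tilde\eta_i^1)=c_i,\qquad G_J(\tilde\eta_i^1)=d_i,\qquad G_A(\tilde\eta_i^1)=\eta_i^2(U_0)-\epsilon\,\eta_i^1(U_0)-d_i\,DJ(\eta_i^1(U_0)).$$ Moreover, letting $F_0(A)=\frac{\epsilon}{2}|A|^2+G(A,J(A))$ for $A\in\mathbb R^{2\times n}$ and $\mathcal K_{F_0}=\{(A,DF_0(A)):A\in\mathbb R^{2\times n}\}$, one has $\eta_i(U_0)\in\mathcal K_{F_0}$ and $\eta_i^1(U_0)\ne\eta_j^1(U_0)$ for all $1\le i\ne j\le N$.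
   Context: $\langle A,B\rangle=\operatorname{tr}(A^TB)$ on $\mathbb R^{2\times n}$. For $A\in\mathbb R^{2\times n}$, $J(A)\in\mathbb R^d$ is the tuple (in a fixed order) of all $2\times2$ subdeterminants of $A$; for $v\in\mathbb R^d$, $v\,DJ(A)\in\mathbb R^{2\times n}$ is the gradient at $A$ of the function $A\mapsto v\cdot J(A)$. For $G=G(A,J)$ on $\mathbb R^{2\times n}\times\mathbb R^d$, $G_A\in\mathbb R^{2\times n}$ and $G_J\in\mathbb R^d$ are the partial gradients. For $p\in\mathbb R^2$, $a\in\mathbb R^n$ put $p\otimes a=pa^T$. For $\mathbf x,\mathbf y,\mathbf z\in\mathbb R^{n-1}$ and $1\le r\le n$ let $\alpha_r(\mathbf x)=(x_1,\dots,x_{r-1},1,x_r,\dots,x_{n-1})^T\in\mathbb R^n$; let $b_r(\mathbf x,\mathbf y)=(y_1,\dots,y_{r-1},-(\mathbf x\cdot\mathbf y),y_r,\dots,y_{n-1})$ (a row vector); and let $\beta_r(\mathbf x,\mathbf y,\mathbf z)\in\mathbb R^{2\times n}$ be the matrix with rows $b_r(\mathbf x,\mathbf y)$ and $b_r(\mathbf x,\mathbf z)$. For $1\le i\le N$ let $r_i\in\{1,\dots,n\}$ with $r_i\equiv i \pmod n$. The $n\times n$ matrix $b_r(\mathbf x,\mathbf y)\otimes\alpha_r(\mathbf x)$ has $(j,k)$ entry $b_r(\mathbf x,\mathbf y)_j\,\alpha_r(\mathbf x)_k$ (it has trace $0$). For $X=(\mathbf x_1,\dots,\mathbf x_N)\in(\mathbb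 R^{n-1})^N$ let $\Delta=\det[\alpha_1(\mathbf x_1)\cdots\alpha_n(\mathbf x_n)]$, and let $T$ be the determinant of the linear map $\mathbb R^{n^2-1}\to\mathbb R^{n^2-1}$ sending $(\mathbf y_1,\dots,\mathbf y_{n+1})$ to the entries other than the $(1,1)$ entry of $\sum_{i=1}^{n+1}b_{r_i}(\mathbf x_i,\mathbf y_i)\otimes\alpha_{r_i}(\mathbf x_i)$. $\mathcal V$ is the set of $(P,X)$, $P=(p_{n+1},\dots,p_N)\in(\mathbb R^2)^{N-n}$, $X\in(\mathbb R^{n-1})^N$, such that $\Delta\neq0$, $T\ne0$, $p_j\neq0$ for $n+1\le j\le N$, and the vectors $p_1,\dots,p_n\in\mathbb R^2$ uniquely determined by $\sum_{i=1}^Np_i\otimes\alpha_{r_i}(\mathbf x_i)=0$ are all nonzero. $\mathcal U$ is the set of $U=(P,X,Y,Z,b,\kappa_1,\dots,\kappa_N)$ with $(P,X)\in\mathcal V$, $Y=(\mathbf y_{n+2},\dots,\mathbf y_N)$, $Z=(\mathbf z_{n+2},\dots,\mathbf z_N)$ with $\mathbf y_j,\mathbf z_j\in\mathbb R^{n-1}$, $b\in\mathbb R^{n-2}$, and $\kappa_i>1$. It is an open subset of a Euclidean space. For $U\in\mathcal U$: $p_1,\dots,p_n\in\mathbb R^2$ are the unique vectors satisfying $\sum_{i=1}^Np_i\otimes\alpha_{r_i}(\mathbf x_i)=0$, where $p_{n+1},\dots,p_N$ are the components of $P$; $\mathbf y_1,\dots,\mathbf y_{n+1}$ (resp. $\mathbf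 z_1,\dots,\mathbf z_{n+1}$) are the unique solutions of $\sum_{i=1}^Nb_{r_i}(\mathbf x_i,\mathbf y_i)\otimes\alpha_{r_i}(\mathbf x_i)=0$ (resp. the same with $\mathbf z_i$ in place of $\mathbf y_i$); $q(b)=(1,1,b_1,\dots,b_{n-2})^T\in\mathbb R^n$; and for $1\le i\le N$: $a_i(U)=\alpha_{r_i}(\mathbf x_i)$, $B_i(U)=\beta_{r_i}(\mathbf x_i,\mathbf y_i,\mathbf z_i)$, $s_i(U)=a_i(U)\cdot q(b)$, $\gamma_i(U)=(p_i\otimes a_i(U),\,s_i(U)B_i(U))\in\mathbb R^{2\times n}\times\mathbb R^{2\times n}$, and $\eta_i(U)=(\eta_i^1(U),\eta_i^2(U))=\gamma_1(U)+\cdots+\gamma_{i-1}(U)+\kappa_i\gamma_i(U)$. *)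

theory Defs
  imports
    "HOL-Analysis.Analysis"
    "HOL-Number_Theory.Cong"
    "Jordan_Normal_Form.Determinant"
begin

(* "$" denotes the components and "\<bullet>" the inner product of real ^ 'n only. *)
no_notation vec_index (infixl "$" 100)
no_notation scalar_prod (infix "\<bullet>" 70)

text \<open>
  Conventions. The dimension \<open>n\<close> is \<open>CARD('n)\<close>. A bijection \<open>pos\<close> from \<open>'n\<close> onto \<open>{1..n}\<close>
  gives the position of each coordinate of \<open>real ^ 'n\<close>. Vectors of length \<open>n - 1\<close> and \<open>n - 2\<close>,
  and families such as \<open>x\<^sub>1, \<dots>, x\<^sub>N\<close>, are functions on \<open>nat\<close> with the 1-based indices of
  the mathematical text, and are extensional where they are components of the parameter \<open>U\<close>.
  A \<open>2 \<times> n\<close> matrix is an element of \<open>real ^ 'n ^ 2\<close>, whose library inner product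
  and norm are \<open>tr (A\<^sup>T B)\<close> and the Frobenius norm.
\<close>


subsection \<open>Smooth functions and gradients\<close>

text \<open>
  On a Euclidean space, continuity of all iterated directional derivatives up to order \<open>k\<close>
  is the \<open>C\<^sup>k\<close> property.
\<close>

primrec times_cont_differentiable ::
    "nat \<Rightarrow> ('a::real_normed_vector \<Rightarrow> 'b::real_normed_vector) \<Rightarrow> bool" where
  "times_cont_differentiable 0 f \<longleftrightarrow> continuous_on UNIV f"
| "times_cont_differentiable (Suc k) f \<longleftrightarrow>
     (\<forall>x. f differentiable (at x)) \<and>
     (\<forall>v. times_cont_differentiable k (\<lambda>x. frechet_derivative f (at x) v))"

definition smooth :: "('a::real_normed_vector \<Rightarrow> 'b::real_normed_vector) \<Rightarrow> bool" where
  "smooth f \<longleftrightarrow> (\<forall>k. times_cont_differentiable k f)"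

definition grad :: "('a::real_inner \<Rightarrow> real) \<Rightarrow> 'a \<Rightarrow> 'a" where
  "grad f x = (THE D. GDERIV f x :> D)"


subsection \<open>Subdeterminants\<close>

text \<open>
  The bijection \<open>pr\<close> from \<open>'d\<close> onto the pairs \<open>(j, k)\<close> with \<open>pos j < pos k\<close> fixes the order
  of the \<open>2 \<times> 2\<close> subdeterminants.
\<close>

definition J :: "('d \<Rightarrow> 'n \<times> 'n) \<Rightarrow> real ^ 'n::finite ^ 2 \<Rightarrow> real ^ 'd::finite" where
  "J pr A = (\<chi> m. Determinants.det
     (\<chi> i l. A $ i $ (if l = 1 then fst (pr m) else snd (pr m)) :: real ^ 2 ^ 2))"

definition dot_DJ ::
    "('d \<Rightarrow> 'n \<times> 'n) \<Rightarrow> real ^ 'd::finite \<Rightarrow> real ^ 'n::finite ^ 2 \<Rightarrow> real ^ 'n ^ 2" where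
  "dot_DJ pr v A = grad (\<lambda>A'. v \<bullet> J pr A') A"

definition outer :: "real ^ 'm::finite \<Rightarrow> real ^ 'n::finite \<Rightarrow> real ^ 'n ^ 'm" where
  "outer p a = (\<chi> j k. p $ j * a $ k)"


subsection \<open>The vectors \<open>\<alpha>\<^sub>r\<close>, \<open>b\<^sub>r\<close> and the matrices \<open>\<beta>\<^sub>r\<close>\<close>

definition alpha :: "('n::finite \<Rightarrow> nat) \<Rightarrow> nat \<Rightarrow> (nat \<Rightarrow> real) \<Rightarrow> real ^ 'n" where
  "alpha pos r x = (\<chi> j. if pos j < r then x (pos j)
                         else if pos j = r then 1
                         else x (pos j - 1))"

definition bvec ::
    "('n::finite \<Rightarrow> nat) \<Rightarrow> nat \<Rightarrow> (nat \<Rightarrow> real) \<Rightarrow> (nat \<Rightarrow> real) \<Rightarrow> real ^ 'n" where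
  "bvec pos r x y = (\<chi> j. if pos j < r then y (pos j)
                          else if pos j = r then - (\<Sum>l = 1..CARD('n) - 1. x l * y l)
                          else y (pos j - 1))"

definition beta ::
    "('n::finite \<Rightarrow> nat) \<Rightarrow> nat \<Rightarrow> (nat \<Rightarrow> real) \<Rightarrow> (nat \<Rightarrow> real) \<Rightarrow> (nat \<Rightarrow> real)
       \<Rightarrow> real ^ 'n ^ 2" where
  "beta pos r x y z = vector [bvec pos r x y, bvec pos r x z]"

definition ridx :: "nat \<Rightarrow> nat \<Rightarrow> nat" where
  "ridx n i = (i - 1) mod n + 1"

lemma ridx_characterization:
  assumes "n \<ge> 1" "i \<ge> 1"
  shows "ridx n i \<in> {1..n}" and "[ridx n i = i] (mod n)"
proof -
  show "ridx n i \<in> {1..n}"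
    using assms by (auto simp: ridx_def Suc_le_eq)
  have "[(i - 1) mod n + 1 = (i - 1) + 1] (mod n)"
    by (intro cong_add) (auto simp: cong_def)
  then show "[ridx n i = i] (mod n)"
    using assms by (simp add: ridx_def)
qed


subsection \<open>The determinants \<open>\<Delta>\<close> and \<open>T\<close>\<close>

definition Delta :: "('n::finite \<Rightarrow> nat) \<Rightarrow> (nat \<Rightarrow> nat \<Rightarrow> real) \<Rightarrow> real" where
  "Delta pos X = Determinants.det (\<chi> j k. alpha pos (pos k) (X (pos k)) $ j :: real ^ 'n ^ 'n)"

definition T_map ::
    "('n::finite \<Rightarrow> nat) \<Rightarrow> (nat \<Rightarrow> nat \<Rightarrow> real) \<Rightarrow> (nat \<Rightarrow> nat \<Rightarrow> real) \<Rightarrow> real ^ 'n ^ 'n" where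
  "T_map pos X Y = (\<Sum>i = 1..CARD('n) + 1.
     outer (bvec pos (ridx CARD('n) i) (X i) (Y i)) (alpha pos (ridx CARD('n) i) (X i)))"

text \<open>
  The coordinates of \<open>(y\<^sub>1, \<dots>, y\<^sub>n\<^sub>+\<^sub>1)\<close> are numbered \<open>0, \<dots>, n\<^sup>2 - 2\<close> in the order
  \<open>y\<^sub>1(1), \<dots>, y\<^sub>1(n-1), y\<^sub>2(1), \<dots>\<close>, and the entries of the \<open>n \<times> n\<close> matrix other than
  the \<open>(1,1)\<close> entry are numbered \<open>0, \<dots>, n\<^sup>2 - 2\<close> row by row. Another numbering changes
  the determinant at most by a sign.
\<close>

definition T_basis :: "nat \<Rightarrow> nat \<Rightarrow> nat \<Rightarrow> nat \<Rightarrow> real" where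
  "T_basis n t i l = (if i = t div (n - 1) + 1 \<and> l = t mod (n - 1) + 1 then 1 else 0)"

definition T_entry :: "('n::finite \<Rightarrow> nat) \<Rightarrow> nat \<Rightarrow> real ^ 'n ^ 'n \<Rightarrow> real" where
  "T_entry pos s M = M $ inv_into UNIV pos ((s + 1) div CARD('n) + 1)
                       $ inv_into UNIV pos ((s + 1) mod CARD('n) + 1)"

definition T_det :: "('n::finite \<Rightarrow> nat) \<Rightarrow> (nat \<Rightarrow> nat \<Rightarrow> real) \<Rightarrow> real" where
  "T_det pos X = Determinant.det (mat (CARD('n)\<^sup>2 - 1) (CARD('n)\<^sup>2 - 1)
     (\<lambda>(s, t). T_entry pos s (T_map pos X (T_basis CARD('n) t))))"


subsection \<open>The sets \<open>\<V>\<close> and \<open>\<U>\<close>\<close>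

text \<open>
  \<open>full_p\<close> is the family \<open>p\<^sub>1, \<dots>, p\<^sub>N\<close> and \<open>full_y\<close> the family \<open>y\<^sub>1, \<dots>, y\<^sub>N\<close>
  (or \<open>z\<^sub>1, \<dots>, z\<^sub>N\<close>); the completions are unique if \<open>\<Delta> \<noteq> 0\<close> and \<open>T \<noteq> 0\<close> respectively.
\<close>

definition full_p ::
    "('n::finite \<Rightarrow> nat) \<Rightarrow> (nat \<Rightarrow> real ^ 2) \<Rightarrow> (nat \<Rightarrow> nat \<Rightarrow> real) \<Rightarrow> nat \<Rightarrow> real ^ 2" where
  "full_p pos P X = (let n = CARD('n); N = 2 * n + 1 in
     THE p. p \<in> {1..N} \<rightarrow>\<^sub>E UNIV \<and> (\<forall>j\<in>{n+1..N}. p j = P j) \<and>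
       (\<Sum>i = 1..N. outer (p i) (alpha pos (ridx n i) (X i))) = 0)"

definition full_y ::
    "('n::finite \<Rightarrow> nat) \<Rightarrow> (nat \<Rightarrow> nat \<Rightarrow> real) \<Rightarrow> (nat \<Rightarrow> nat \<Rightarrow> real) \<Rightarrow> nat \<Rightarrow> nat \<Rightarrow> real" where
  "full_y pos X Y = (let n = CARD('n); N = 2 * n + 1 in
     THE y. y \<in> {1..N} \<rightarrow>\<^sub>E ({1..n-1} \<rightarrow>\<^sub>E UNIV) \<and> (\<forall>j\<in>{n+2..N}. y j = Y j) \<and>
       (\<Sum>i = 1..N. outer (bvec pos (ridx n i) (X i) (y i)) (alpha pos (ridx n i) (X i))) = 0)"

definition V_set ::
    "('n::finite \<Rightarrow> nat) \<Rightarrow> ((nat \<Rightarrow> real ^ 2) \<times> (nat \<Rightarrow> nat \<Rightarrow> real)) set" where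
  "V_set pos = (let n = CARD('n); N = 2 * n + 1 in
     {(P, X). P \<in> {n+1..N} \<rightarrow>\<^sub>E UNIV \<and> X \<in> {1..N} \<rightarrow>\<^sub>E ({1..n-1} \<rightarrow>\<^sub>E UNIV) \<and>
        Delta pos X \<noteq> 0 \<and> T_det pos X \<noteq> 0 \<and> (\<forall>j\<in>{n+1..N}. P j \<noteq> 0) \<and>
        (\<forall>i\<in>{1..n}. full_p pos P X i \<noteq> 0)})"

record params =
  par_P :: "nat \<Rightarrow> real ^ 2"
  par_X :: "nat \<Rightarrow> nat \<Rightarrow> real"
  par_Y :: "nat \<Rightarrow> nat \<Rightarrow> real"
  par_Z :: "nat \<Rightarrow> nat \<Rightarrow> real"
  par_b :: "nat \<Rightarrow> real"
  par_kappa :: "nat \<Rightarrow> real"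

definition U_set :: "('n::finite \<Rightarrow> nat) \<Rightarrow> params set" where
  "U_set pos = (let n = CARD('n); N = 2 * n + 1 in
     {U. (par_P U, par_X U) \<in> V_set pos \<and>
         par_Y U \<in> {n+2..N} \<rightarrow>\<^sub>E ({1..n-1} \<rightarrow>\<^sub>E UNIV) \<and>
         par_Z U \<in> {n+2..N} \<rightarrow>\<^sub>E ({1..n-1} \<rightarrow>\<^sub>E UNIV) \<and>
         par_b U \<in> {1..n-2} \<rightarrow>\<^sub>E UNIV \<and>
         par_kappa U \<in> {1..N} \<rightarrow>\<^sub>E {1<..}})"


subsection \<open>The points \<open>\<eta>\<^sub>i(U)\<close>\<close>

definition qvec :: "('n::finite \<Rightarrow> nat) \<Rightarrow> (nat \<Rightarrow> real) \<Rightarrow> real ^ 'n" where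
  "qvec pos b = (\<chi> j. if pos j \<le> 2 then 1 else b (pos j - 2))"

definition avec :: "('n::finite \<Rightarrow> nat) \<Rightarrow> params \<Rightarrow> nat \<Rightarrow> real ^ 'n" where
  "avec pos U i = alpha pos (ridx CARD('n) i) (par_X U i)"

definition Bmat :: "('n::finite \<Rightarrow> nat) \<Rightarrow> params \<Rightarrow> nat \<Rightarrow> real ^ 'n ^ 2" where
  "Bmat pos U i = beta pos (ridx CARD('n) i) (par_X U i)
     (full_y pos (par_X U) (par_Y U) i) (full_y pos (par_X U) (par_Z U) i)"

definition gamma :: "('n::finite \<Rightarrow> nat) \<Rightarrow> params \<Rightarrow> nat \<Rightarrow> (real ^ 'n ^ 2) \<times> (real ^ 'n ^ 2)" where
  "gamma pos U i = (outer (full_p pos (par_P U) (par_X U) i) (avec pos U i),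
                    (avec pos U i \<bullet> qvec pos (par_b U)) *\<^sub>R Bmat pos U i)"

definition eta :: "('n::finite \<Rightarrow> nat) \<Rightarrow> params \<Rightarrow> nat \<Rightarrow> (real ^ 'n ^ 2) \<times> (real ^ 'n ^ 2)" where
  "eta pos U i = (\<Sum>l = 1..<i. gamma pos U l) + par_kappa U i *\<^sub>R gamma pos U i"

abbreviation eta1 :: "('n::finite \<Rightarrow> nat) \<Rightarrow> params \<Rightarrow> nat \<Rightarrow> real ^ 'n ^ 2" where
  "eta1 pos U i \<equiv> fst (eta pos U i)"

abbreviation eta2 :: "('n::finite \<Rightarrow> nat) \<Rightarrow> params \<Rightarrow> nat \<Rightarrow> real ^ 'n ^ 2" where
  "eta2 pos U i \<equiv> snd (eta pos U i)"


subsection \<open>The function \<open>F\<^sub>0\<close> and the set \<open>\<K>\<close>\<close>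

definition F0 ::
    "('d \<Rightarrow> 'n \<times> 'n) \<Rightarrow> real \<Rightarrow> ((real ^ 'n::finite ^ 2) \<times> (real ^ 'd::finite) \<Rightarrow> real)
       \<Rightarrow> real ^ 'n ^ 2 \<Rightarrow> real" where
  "F0 pr \<epsilon> G A = \<epsilon> / 2 * (norm A)\<^sup>2 + G (A, J pr A)"

definition K_set :: "('a::real_inner \<Rightarrow> real) \<Rightarrow> ('a \<times> 'a) set" where
  "K_set F = {(A, grad F A) | A. True}"

end

theory Submission
  imports Defs "HOL-Real_Asymp.Real_Asymp"
begin

text \<open>
  Expanding the quadratic map \<open>J\<close> turns the hypothesis into a strict affine inequality
  \<open>c\<^sub>j > c\<^sub>i + g\<^sub>i \<bullet> (x\<^sub>j - x\<^sub>i)\<close> between the lifted points \<open>x\<^sub>i = (\<eta>\<^sub>i\<^sup>1, J \<eta>\<^sub>i\<^sup>1)\<close>, up to a term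
  \<open>O(\<epsilon>)\<close>, which is harmless for small \<open>\<epsilon>\<close> as there are finitely many pairs. So near \<open>x\<^sub>i\<close> the
  maximum of the affine functions \<open>l\<^sub>j(x) = c\<^sub>j + g\<^sub>j \<bullet> (x - x\<^sub>j)\<close> is \<open>l\<^sub>i\<close>. Iterating the smooth
  convex substitute \<open>a + \<phi>(b - a)\<close> for \<open>max a b\<close>, where \<open>\<phi>(t) = max t 0\<close> for \<open>\<bar>t\<bar> \<ge> \<delta>\<close>, gives a
  smooth convex \<open>G\<close> that still equals \<open>l\<^sub>i\<close> near \<open>x\<^sub>i\<close>.
\<close>

section \<open>Smooth functions\<close>

text \<open>Derivatives are unique, so any explicit derivative \<open>f'\<close> may stand in for
  \<open>frechet_derivative\<close> in the recursion.\<close>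

lemma times_cont_differentiable_SucI:
  assumes "\<And>x. (f has_derivative f' x) (at x)"
    and "\<And>v. times_cont_differentiable k (\<lambda>x. f' x v)"
  shows "times_cont_differentiable (Suc k) f"
proof -
  have "frechet_derivative f (at x) = f' x" for x
    using frechet_derivative_at[OF assms(1)] by metis
  then show ?thesis
    using assms by (auto simp: differentiable_def)
qed

lemma times_cont_differentiable_SucD:
  assumes "times_cont_differentiable (Suc k) f"
  shows "(f has_derivative frechet_derivative f (at x)) (at x)"
    and "times_cont_differentiable k (\<lambda>x. frechet_derivative f (at x) v)"
  using assms frechet_derivative_works by auto

text \<open>The product and chain rules leave undifferentiated factors beside derivatives; this
  lowers their order to match.\<close>

lemma times_cont_differentiable_pred:
  "times_cont_differentiable (Suc k) f \<Longrightarrow> times_cont_differentiable k f"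
proof (induction k arbitrary: f)
  case 0
  then show ?case
    by (auto intro!: differentiable_imp_continuous_on simp: differentiable_on_def)
next
  case (Suc k)
  show ?case
    using Suc.IH Suc.prems
    by (metis times_cont_differentiable.simps(2))
qed

lemma times_cont_differentiable_const: "times_cont_differentiable k (\<lambda>x. c)"
proof (induction k arbitrary: c)
  case (Suc k)
  show ?case
    by (rule times_cont_differentiable_SucI[of _ "\<lambda>_ _. 0"]) (auto intro: Suc)
qed auto

lemma times_cont_differentiable_bounded_linear:
  assumes "bounded_linear f"
  shows "times_cont_differentiable k f"
proof (cases k)
  case 0
  then show ?thesis
    using assms by (simp add: linear_continuous_on)
next
  case (Suc j)
  show ?thesis
    unfolding Suc
    by (rule times_cont_differentiable_SucI[of _ "\<lambda>_. f"])
      (auto intro: bounded_linear_imp_has_derivative assms times_cont_differentiable_const)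
qed

lemma times_cont_differentiable_add:
  "times_cont_differentiable k f \<Longrightarrow> times_cont_differentiable k g \<Longrightarrow>
    times_cont_differentiable k (\<lambda>x. f x + g x)"
proof (induction k arbitrary: f g)
  case 0
  then show ?case by (auto intro: continuous_on_add)
next
  case (Suc k)
  show ?case
    by (rule times_cont_differentiable_SucI[OF has_derivative_add])
      (use Suc.prems in \<open>auto simp: frechet_derivative_works intro!: Suc.IH\<close>)
qed

lemma times_cont_differentiable_mult:
  fixes f g :: "'a::real_normed_vector \<Rightarrow> real"
  shows "times_cont_differentiable k f \<Longrightarrow> times_cont_differentiable k g \<Longrightarrow>
    times_cont_differentiable k (\<lambda>x. f x * g x)"
proof (induction k arbitrary: f g)
  case 0
  then show ?case by (auto intro: continuous_on_mult)
next
  case (Suc k)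
  show ?case
    by (rule times_cont_differentiable_SucI[OF has_derivative_mult])
      (use Suc.prems times_cont_differentiable_pred[OF Suc.prems(1)]
         times_cont_differentiable_pred[OF Suc.prems(2)] in
        \<open>auto simp: frechet_derivative_works
           intro!: Suc.IH times_cont_differentiable_add\<close>)
qed

lemma smooth_const: "smooth (\<lambda>x. c)"
  by (simp add: smooth_def times_cont_differentiable_const)

lemma smooth_bounded_linear: "bounded_linear f \<Longrightarrow> smooth f"
  by (simp add: smooth_def times_cont_differentiable_bounded_linear)

lemma smooth_ident: "smooth (\<lambda>x. x)"
  by (simp add: smooth_bounded_linear)

lemma smooth_add: "smooth f \<Longrightarrow> smooth g \<Longrightarrow> smooth (\<lambda>x. f x + g x)"
  by (simp add: smooth_def times_cont_differentiable_add)

lemma smooth_mult: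
  fixes f g :: "'a::real_normed_vector \<Rightarrow> real"
  shows "smooth f \<Longrightarrow> smooth g \<Longrightarrow> smooth (\<lambda>x. f x * g x)"
  by (simp add: smooth_def times_cont_differentiable_mult)

lemma smooth_frechet_derivative: "smooth f \<Longrightarrow> smooth (\<lambda>x. frechet_derivative f (at x) v)"
  unfolding smooth_def by (metis times_cont_differentiable.simps(2))

lemma smooth_has_frechet_derivative:
  "smooth f \<Longrightarrow> (f has_derivative frechet_derivative f (at x)) (at x)"
  unfolding smooth_def by (metis times_cont_differentiable_SucD(1))

text \<open>The chain rule replaces \<open>\<phi>\<close> by its derivative, so the induction on
  \<open>k\<close> keeps \<open>\<phi>\<close> arbitrary. As \<open>\<phi>\<close> acts on reals,
  the derivative is an ordinary product and the product rule of order \<open>k\<close>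
  applies.\<close>

lemma times_cont_differentiable_compose:
  fixes \<phi> :: "real \<Rightarrow> real" and f :: "'a::real_normed_vector \<Rightarrow> real"
  shows "smooth \<phi> \<Longrightarrow> times_cont_differentiable k f \<Longrightarrow>
    times_cont_differentiable k (\<lambda>x. \<phi> (f x))"
proof (induction k arbitrary: \<phi>)
  case 0
  have "continuous_on UNIV \<phi>"
    using 0(1) unfolding smooth_def by (metis times_cont_differentiable.simps(1))
  then show ?case
    using 0(2) by (auto intro: continuous_on_compose2)
next
  case (Suc k)
  let ?D = "frechet_derivative f" and ?d = "\<lambda>t. frechet_derivative \<phi> (at t) 1"
  \<comment> \<open>A linear map on the reals is multiplication by its value at 1.\<close>
  have lin: "frechet_derivative \<phi> (at t) u = u * ?d t" for t u
    using has_derivative_linear[OF smooth_has_frechet_derivative[OF Suc.prems(1)]]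
    by (metis linear_scale mult.right_neutral real_scaleR_def)
  have "((\<lambda>x. \<phi> (f x)) has_derivative (\<lambda>v. ?D (at x) v * ?d (f x))) (at x)" for x
    using has_derivative_compose[OF times_cont_differentiable_SucD(1)[OF Suc.prems(2), of x]
        smooth_has_frechet_derivative[OF Suc.prems(1)]]
    by (simp only: lin[of _ "frechet_derivative f (at x) v" for v])
  moreover have "times_cont_differentiable k (\<lambda>x. ?d (f x))"
    by (rule Suc.IH[OF smooth_frechet_derivative[OF Suc.prems(1)]
          times_cont_differentiable_pred[OF Suc.prems(2)]])
  ultimately show ?case
    by (intro times_cont_differentiable_SucI[of _ "\<lambda>x v. ?D (at x) v * ?d (f x)"]
        times_cont_differentiable_mult times_cont_differentiable_SucD(2)[OF Suc.prems(2)])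
qed

lemma smooth_compose:
  fixes \<phi> :: "real \<Rightarrow> real" and f :: "'a::real_normed_vector \<Rightarrow> real"
  shows "smooth \<phi> \<Longrightarrow> smooth f \<Longrightarrow> smooth (\<lambda>x. \<phi> (f x))"
  using times_cont_differentiable_compose unfolding smooth_def[of f]
  by (auto simp: smooth_def[of "\<lambda>x. \<phi> (f x)"])

lemma smooth_realI:
  fixes f :: "real \<Rightarrow> real"
  assumes "\<And>t. (f has_real_derivative f' t) (at t)" and "smooth f'"
  shows "smooth f"
  unfolding smooth_def
proof
  fix k
  have "times_cont_differentiable (Suc k) f"
    by (rule times_cont_differentiable_SucI[of _ "\<lambda>t v. f' t * v"])
      (use assms in \<open>auto simp: has_field_derivative_def smooth_def
        intro: times_cont_differentiable_mult times_cont_differentiable_const\<close>)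
  then show "times_cont_differentiable k f"
    by (rule times_cont_differentiable_pred)
qed


section \<open>A smooth maximum that is exact away from the diagonal\<close>

text \<open>The case \<open>j = 0\<close> is the classical flat function. The powers of
  \<open>1 / t\<close> make the family closed under differentiation up to linear
  combinations.\<close>

definition exp_inv :: "nat \<Rightarrow> real \<Rightarrow> real" where
  "exp_inv j t = (if t > 0 then (1 / t) ^ j * exp (- (1 / t)) else 0)"

text \<open>From the right, the exponential beats every power of \<open>1 / t\<close>; on the left
  the function vanishes.\<close>

lemma exp_inv_tendsto_0: "(exp_inv j \<longlongrightarrow> 0) (at 0)"
proof -
  have "((\<lambda>t. (1 / t) ^ j * exp (- (1 / t))) \<longlongrightarrow> 0) (at_right (0::real))"
    by real_asymp
  then have "(exp_inv j \<longlongrightarrow> 0) (at_right 0)"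
    by (rule Lim_transform_eventually)
      (auto simp: exp_inv_def eventually_at_filter)
  moreover have "(exp_inv j \<longlongrightarrow> 0) (at_left 0)"
    by (rule Lim_transform_eventually[OF tendsto_const])
      (auto simp: exp_inv_def eventually_at_filter)
  ultimately show ?thesis
    by (simp add: filterlim_split_at)
qed

lemma exp_inv_DERIV:
  "(exp_inv j has_real_derivative exp_inv (j + 2) t - real j * exp_inv (j + 1) t) (at t)"
proof -
  consider "t > 0" | "t < 0" | "t = 0" by linarith
  then show ?thesis
  proof cases
    case 1
    have "((\<lambda>t. (1 / t) ^ j * exp (- (1 / t))) has_real_derivative
        exp_inv (j + 2) t - real j * exp_inv (j + 1) t) (at t)"
      using 1 by (cases j)
        (auto simp: exp_inv_def field_simps power2_eq_square intro!: derivative_eq_intros,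
          metis Suc_pred gr0I power_Suc)
    then show ?thesis
      by (rule has_field_derivative_transform_within_open[where S = "{0<..}"])
        (use 1 in \<open>auto simp: exp_inv_def\<close>)
  next
    case 2
    have "((\<lambda>t. 0) has_real_derivative 0) (at t)" by simp
    then have "(exp_inv j has_real_derivative 0) (at t)"
      by (rule has_field_derivative_transform_within_open[where S = "{..<0}"])
        (use 2 in \<open>auto simp: exp_inv_def\<close>)
    then show ?thesis
      using 2 by (simp add: exp_inv_def)
  next
    case 3
    \<comment> \<open>For \<open>h \<noteq> 0\<close> this difference quotient is
      \<open>exp_inv (Suc j) h\<close>.\<close>
    have "((\<lambda>h. (exp_inv j (0 + h) - exp_inv j 0) / h) \<longlongrightarrow> 0) (at 0)"
      by (rule Lim_transform_eventually[OF exp_inv_tendsto_0[of "Suc j"]])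
        (auto simp: exp_inv_def eventually_at_filter)
    then show ?thesis
      using 3 by (simp add: DERIV_def exp_inv_def)
  qed
qed

text \<open>The derivative involves the indices \<open>j + 1\<close> and \<open>j + 2\<close>, so
  the induction on the order treats all \<open>j\<close> at once.\<close>

lemma smooth_exp_inv: "smooth (exp_inv j)"
proof -
  have "times_cont_differentiable k (exp_inv j)" for k
  proof (induction k arbitrary: j)
    case 0
    show ?case
      using exp_inv_DERIV by (auto intro!: DERIV_continuous_on)
  next
    case (Suc k)
    show ?case
    proof (rule times_cont_differentiable_SucI)
      show "(exp_inv j has_derivative
          (\<lambda>v. (exp_inv (j + 2) t + (- real j) * exp_inv (j + 1) t) * v)) (at t)" for t
        using exp_inv_DERIV[of j t] by (simp add: has_field_derivative_def)
    qed (intro times_cont_differentiable_mult times_cont_differentiable_add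
        times_cont_differentiable_const Suc)
  qed
  then show ?thesis by (simp add: smooth_def)
qed

section \<open>Primitives, a smooth step and a smooth positive part\<close>

lemma smooth_continuous_real:
  fixes f :: "real \<Rightarrow> real"
  assumes "smooth f"
  shows "isCont f t"
  by (rule has_derivative_continuous[OF smooth_has_frechet_derivative[OF assms]])

lemma smooth_antiderivative:
  fixes f :: "real \<Rightarrow> real"
  assumes "smooth f"
  obtains F where "smooth F" "\<And>t. (F has_real_derivative f t) (at t)"
proof -
  \<comment> \<open>The extended-real interval is the whole line, so both bounds on \<open>t\<close>
    are vacuous.\<close>
  have "\<exists>F. \<forall>t. - \<infinity> < ereal t \<longrightarrow> ereal t < \<infinity> \<longrightarrow> (F has_vector_derivative f t) (at t)"
    by (rule einterval_antiderivative) (auto intro: smooth_continuous_real assms)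
  then obtain F where "\<And>t. (F has_real_derivative f t) (at t)"
    by (auto simp: has_real_derivative_iff_has_vector_derivative)
  then show thesis
    using smooth_realI assms that by blast
qed

text \<open>The step is the primitive of a nonnegative bump, normalised to rise from 0 to 1.\<close>

lemma smooth_step:
  obtains \<sigma> :: "real \<Rightarrow> real"
  where "smooth \<sigma>" "mono \<sigma>" "\<And>t. t \<le> 0 \<Longrightarrow> \<sigma> t = 0" "\<And>t. t \<ge> 1 \<Longrightarrow> \<sigma> t = 1"
proof -
  \<comment> \<open>The bump is positive exactly on (0, 1). Differences are written with sums and
    products to fit the closure rules for \<open>smooth\<close>.\<close>
  define \<psi> where "\<psi> t = exp_inv 0 t * exp_inv 0 (1 + - 1 * t)" for t
  have nonneg: "\<psi> t \<ge> 0" for t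
    by (simp add: \<psi>_def exp_inv_def)
  have pos: "\<psi> t > 0" if "0 < t" "t < 1" for t
    using that by (simp add: \<psi>_def exp_inv_def)
  have zero: "\<psi> t = 0" if "t \<le> 0 \<or> t \<ge> 1" for t
    using that by (auto simp: \<psi>_def exp_inv_def)
  have "smooth \<psi>"
    unfolding \<psi>_def
    by (intro smooth_mult smooth_exp_inv smooth_compose[OF smooth_exp_inv] smooth_add
        smooth_const smooth_ident)
  then obtain F where F: "smooth F" "\<And>t. (F has_real_derivative \<psi> t) (at t)"
    using smooth_antiderivative by blast
  have mono: "F s \<le> F t" if "s \<le> t" for s t
    using DERIV_nonneg_imp_nondecreasing[OF that, of F] F(2) nonneg by blast
  have "F 0 < F 1"
  proof (rule DERIV_pos_imp_increasing_open[where f = F])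
    show "\<exists>y. (F has_real_derivative y) (at t) \<and> y > 0" if "0 < t" "t < 1" for t
      using F(2) pos that by blast
    show "continuous_on {0..1} F"
      by (rule DERIV_continuous_on[OF has_field_derivative_at_within[OF F(2)]])
  qed simp
  \<comment> \<open>The interval from \<open>s\<close> to \<open>t\<close> misses (0, 1), so the
    bump vanishes on it.\<close>
  have const: "F s = F t" if "s < t" "t \<le> 0 \<or> s \<ge> 1" for s t
  proof (rule antisym)
    show "F s \<le> F t"
      using mono that(1) by simp
    show "F t \<le> F s"
    proof (rule DERIV_nonpos_imp_nonincreasing[where f = F])
      show "\<exists>y. (F has_real_derivative y) (at u) \<and> y \<le> 0" if "s \<le> u" "u \<le> t" for u
        using F(2)[of u] zero[of u] that \<open>t \<le> 0 \<or> s \<ge> 1\<close> by auto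
    qed (use that in simp)
  qed
  show thesis
  proof
    show "smooth (\<lambda>t. (F t + - F 0) * (1 / (F 1 - F 0)))"
      by (intro smooth_mult smooth_add smooth_const F(1))
    show "mono (\<lambda>t. (F t + - F 0) * (1 / (F 1 - F 0)))"
      using \<open>F 0 < F 1\<close> mono by (auto intro!: monoI divide_right_mono)
    show "(F t + - F 0) * (1 / (F 1 - F 0)) = 0" if "t \<le> 0" for t
      using const[of t 0] that by (cases "t = 0") auto
    show "(F t + - F 0) * (1 / (F 1 - F 0)) = 1" if "t \<ge> 1" for t
      using const[of 1 t] that \<open>F 0 < F 1\<close> by (cases "t = 1") auto
  qed
qed

text \<open>A shifted primitive of the step has slope increasing from 0 to 1: it is convex, monotone
  and 1-Lipschitz. The Lipschitz bound later makes \<open>a + \<phi> (b - a)\<close> monotone in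
  \<open>a\<close>.\<close>

lemma smooth_positive_part_unit:
  obtains \<phi> :: "real \<Rightarrow> real"
  where "smooth \<phi>" "convex_on UNIV \<phi>" "mono \<phi>" "\<And>s t. s \<le> t \<Longrightarrow> \<phi> t - \<phi> s \<le> t - s"
    "\<And>t. t \<le> -1 \<Longrightarrow> \<phi> t = 0" "\<And>t. t \<ge> 1 \<Longrightarrow> \<phi> t = t"
proof -
  obtain \<sigma> :: "real \<Rightarrow> real" where \<sigma>: "smooth \<sigma>" "mono \<sigma>" "\<And>t. t \<le> 0 \<Longrightarrow> \<sigma> t = 0" "\<And>t. t \<ge> 1 \<Longrightarrow> \<sigma> t = 1"
    using smooth_step by blast
  have bounds: "0 \<le> \<sigma> t" "\<sigma> t \<le> 1" for t
    using monoD[OF \<sigma>(2), of "min t 0" t] monoD[OF \<sigma>(2), of t "max t 1"] \<sigma>(3,4) by auto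
  obtain F where F: "smooth F" "\<And>t. (F has_real_derivative \<sigma> t) (at t)"
    using smooth_antiderivative[OF \<sigma>(1)] by blast
  have mono: "F s \<le> F t" if "s \<le> t" for s t
    using DERIV_nonneg_imp_nondecreasing[OF that, of F] F(2) bounds by blast
  \<comment> \<open>The slope of \<open>t - F t\<close> is nonnegative, which gives the Lipschitz
    bound, and zero beyond 1, which makes \<open>F\<close> affine there.\<close>
  have D: "((\<lambda>t. t - F t) has_real_derivative 1 - \<sigma> t) (at t)" for t
    by (intro derivative_intros F(2))
  have lip: "s - F s \<le> t - F t" if "s \<le> t" for s t
    by (rule DERIV_nonneg_imp_nondecreasing[OF that])
      (metis D bounds(2) diff_ge_0_iff_ge)
  have left: "F t = F 0" if "t \<le> 0" for t
  proof (rule antisym[OF mono[OF that]])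
    show "F 0 \<le> F t"
      by (rule DERIV_nonpos_imp_nonincreasing[OF that]) (metis F(2) \<sigma>(3) order_refl)
  qed
  have right: "t - F t = 1 - F 1" if "t \<ge> 1" for t
  proof (rule antisym[OF _ lip[OF that]])
    show "t - F t \<le> 1 - F 1"
      by (rule DERIV_nonpos_imp_nonincreasing[OF that]) (metis D \<sigma>(4) diff_self order_refl)
  qed
  \<comment> \<open>The translation by \<open>s\<close> makes the affine branch on the right pass through the origin.\<close>
  define s where "s = 1 - (F 1 - F 0)"
  \<comment> \<open>This keeps the transition zone, from \<open>- s\<close> to \<open>1 - s\<close>,
    inside [-1, 1].\<close>
  have s: "0 \<le> s" "s \<le> 1"
    using lip[of 0 1] mono[of 0 1] by (auto simp: s_def)
  define \<phi> where "\<phi> t = F (t + s) + - F 0" for t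
  show thesis
  proof
    show "smooth \<phi>"
      unfolding \<phi>_def
      by (intro smooth_add smooth_compose[OF F(1)] smooth_const smooth_ident)
    have "(\<phi> has_real_derivative \<sigma> (t + s)) (at t)" for t
      unfolding \<phi>_def using DERIV_shift[of F _ t s] F(2)
      by (auto intro!: derivative_eq_intros)
    then show "convex_on UNIV \<phi>"
      by (intro convex_on_realI[where f' = "\<lambda>t. \<sigma> (t + s)"]) (auto intro: monoD[OF \<sigma>(2)])
    show "mono \<phi>"
      by (auto simp: \<phi>_def intro!: monoI mono)
    show "\<phi> v - \<phi> u \<le> v - u" if "u \<le> v" for u v
      using lip[of "u + s" "v + s"] that by (simp add: \<phi>_def)
    show "\<phi> t = 0" if "t \<le> -1" for t
      using left[of "t + s"] s that by (simp add: \<phi>_def)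
    show "\<phi> t = t" if "t \<ge> 1" for t
      using right[of "t + s"] s that by (simp add: \<phi>_def s_def)
  qed
qed

text \<open>Rescaling to \<open>\<delta> * \<phi> (t / \<delta>)\<close> preserves slopes and
  shrinks the transition zone to width \<open>2 * \<delta>\<close>.\<close>

lemma smooth_positive_part:
  fixes \<delta> :: real
  assumes "\<delta> > 0"
  obtains \<phi> :: "real \<Rightarrow> real"
  where "smooth \<phi>" "convex_on UNIV \<phi>" "mono \<phi>" "\<And>s t. s \<le> t \<Longrightarrow> \<phi> t - \<phi> s \<le> t - s"
    "\<And>t. t \<le> - \<delta> \<Longrightarrow> \<phi> t = 0" "\<And>t. t \<ge> \<delta> \<Longrightarrow> \<phi> t = t"
proof -
  obtain \<phi> :: "real \<Rightarrow> real"
    where \<phi>: "smooth \<phi>" "convex_on UNIV \<phi>" "mono \<phi>" "\<And>s t. s \<le> t \<Longrightarrow> \<phi> t - \<phi> s \<le> t - s"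
      "\<And>t. t \<le> -1 \<Longrightarrow> \<phi> t = 0" "\<And>t. t \<ge> 1 \<Longrightarrow> \<phi> t = t"
    using smooth_positive_part_unit by blast
  let ?\<phi> = "\<lambda>t. \<delta> * \<phi> (1 / \<delta> * t)"
  show thesis
  proof
    show "smooth ?\<phi>"
      by (intro smooth_mult smooth_const smooth_compose[OF \<phi>(1)] smooth_ident)
    show "convex_on UNIV ?\<phi>"
    proof (rule convex_onI)
      fix u x y :: real
      assume "0 < u" "u < 1"
      then have "\<phi> ((1 - u) *\<^sub>R (x / \<delta>) + u *\<^sub>R (y / \<delta>)) \<le> (1 - u) * \<phi> (x / \<delta>) + u * \<phi> (y / \<delta>)"
        by (intro convex_onD[OF \<phi>(2)]) auto
      from mult_left_mono[OF this, of \<delta>]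
      show "?\<phi> ((1 - u) *\<^sub>R x + u *\<^sub>R y) \<le> (1 - u) * ?\<phi> x + u * ?\<phi> y"
        using assms by (simp add: algebra_simps add_divide_distrib diff_divide_distrib)
    qed simp
    show "mono ?\<phi>"
      using assms by (auto intro!: monoI mult_left_mono monoD[OF \<phi>(3)] divide_right_mono)
    show "?\<phi> t - ?\<phi> s \<le> t - s" if "s \<le> t" for s t
      using mult_left_mono[OF \<phi>(4)[of "s / \<delta>" "t / \<delta>"], of \<delta>] assms that
      by (simp add: divide_right_mono right_diff_distrib)
    show "?\<phi> t = 0" if "t \<le> - \<delta>" for t
      using assms that \<phi>(5)[of "t / \<delta>"] by (simp add: field_simps)
    show "?\<phi> t = t" if "t \<ge> \<delta>" for t
      using assms that \<phi>(6)[of "t / \<delta>"] by (simp add: field_simps)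
  qed
qed


text \<open>Functions are added one at a time through a smooth maximum, each costing at most one
  \<open>\<delta>\<close> of error. The upper bound strengthens the induction: when the new function
  dominates, the old ones need not have a clear winner, so exactness says nothing about
  \<open>G\<close>.\<close>

lemma smooth_convex_max:
  fixes l :: "'i \<Rightarrow> 'a::real_normed_vector \<Rightarrow> real"
  assumes "\<delta> > 0" "finite I" "I \<noteq> {}"
    and "\<And>i. i \<in> I \<Longrightarrow> smooth (l i)" "\<And>i. i \<in> I \<Longrightarrow> convex_on UNIV (l i)"
  shows "\<exists>G. smooth G \<and> convex_on UNIV G \<and>
    (\<forall>x t. (\<forall>i\<in>I. l i x \<le> t) \<longrightarrow> G x \<le> t + real (card I) * \<delta>) \<and>
    (\<forall>x. \<forall>i\<in>I. (\<forall>j\<in>I - {i}. l j x + real (card I) * \<delta> \<le> l i x) \<longrightarrow> G x = l i x)"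
  using assms(2-)
proof (induction rule: finite_ne_induct)
  case (singleton i)
  then show ?case
    using \<open>\<delta> > 0\<close> by (intro exI[of _ "l i"]) auto
next
  case (insert k I)
  obtain G where G: "smooth G" "convex_on UNIV G"
    and upper: "\<And>x t. \<forall>i\<in>I. l i x \<le> t \<Longrightarrow> G x \<le> t + real (card I) * \<delta>"
    and exact: "\<And>x i. i \<in> I \<Longrightarrow> \<forall>j\<in>I - {i}. l j x + real (card I) * \<delta> \<le> l i x \<Longrightarrow> G x = l i x"
    using insert.IH insert.prems by (metis insertCI)
  obtain \<phi> :: "real \<Rightarrow> real"
    where \<phi>: "smooth \<phi>" "convex_on UNIV \<phi>" "mono \<phi>" "\<And>s t. s \<le> t \<Longrightarrow> \<phi> t - \<phi> s \<le> t - s"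
      "\<And>t. t \<le> - \<delta> \<Longrightarrow> \<phi> t = 0" "\<And>t. t \<ge> \<delta> \<Longrightarrow> \<phi> t = t"
    using smooth_positive_part[OF \<open>\<delta> > 0\<close>] by blast
  define m where "m a b = a + \<phi> (b - a)" for a b
  \<comment> \<open>Monotone in the first argument since \<open>\<phi>\<close> is 1-Lipschitz, in
    the second since \<open>\<phi>\<close> is monotone.\<close>
  have m_mono: "m a b \<le> m a' b'" if "a \<le> a'" "b \<le> b'" for a b a' b'
  proof -
    have "m a b \<le> m a' b"
      using \<phi>(4)[of "b - a'" "b - a"] that by (simp add: m_def)
    also have "\<dots> \<le> m a' b'"
      using monoD[OF \<phi>(3), of "b - a'" "b' - a'"] that by (simp add: m_def)
    finally show ?thesis .
  qed
  have m_convex: "m ((1 - u) * a + u * a') ((1 - u) * b + u * b') \<le> (1 - u) * m a b + u * m a' b'"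
    if "0 \<le> u" "u \<le> 1" for u a a' b b'
    using convex_onD[OF \<phi>(2), of u "b - a" "b' - a'"] that
    by (simp add: m_def algebra_simps)
  have m_upper: "m t t \<le> t + \<delta>" for t
    using monoD[OF \<phi>(3), of 0 \<delta>] \<phi>(6)[of \<delta>] \<open>\<delta> > 0\<close> by (simp add: m_def)
  have card: "real (card (insert k I)) = real (card I) + 1"
    using insert by simp
  show ?case
  proof (intro exI[of _ "\<lambda>x. m (G x) (l k x)"] conjI allI impI ballI)
    have "smooth (\<lambda>x. G x + \<phi> (l k x + - 1 * G x))"
      by (intro smooth_add smooth_compose[OF \<phi>(1)] smooth_mult smooth_const G insert.prems) simp
    then show "smooth (\<lambda>x. m (G x) (l k x))"
      by (simp add: m_def)
    show "convex_on UNIV (\<lambda>x. m (G x) (l k x))"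
    proof (rule convex_onI)
      fix u :: real and x y
      assume u: "0 < u" "u < 1"
      \<comment> \<open>Monotonicity of \<open>m\<close> lets the convexity inequalities of both
        arguments pass through it.\<close>
      have "m (G ((1 - u) *\<^sub>R x + u *\<^sub>R y)) (l k ((1 - u) *\<^sub>R x + u *\<^sub>R y))
          \<le> m ((1 - u) * G x + u * G y) ((1 - u) * l k x + u * l k y)"
        using u by (intro m_mono convex_onD[OF G(2)] convex_onD[OF insert.prems(2)[of k]]) auto
      also have "\<dots> \<le> (1 - u) * m (G x) (l k x) + u * m (G y) (l k y)"
        using u by (intro m_convex) auto
      finally show "m (G ((1 - u) *\<^sub>R x + u *\<^sub>R y)) (l k ((1 - u) *\<^sub>R x + u *\<^sub>R y))
          \<le> (1 - u) * m (G x) (l k x) + u * m (G y) (l k y)" .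
    qed simp
    fix x
    show "m (G x) (l k x) \<le> t + real (card (insert k I)) * \<delta>"
      if "\<forall>i\<in>insert k I. l i x \<le> t" for t
    proof -
      have "0 \<le> real (card I) * \<delta>"
        using \<open>\<delta> > 0\<close> by simp
      then have "m (G x) (l k x) \<le> m (t + real (card I) * \<delta>) (t + real (card I) * \<delta>)"
        using that upper[of x t] by (intro m_mono) auto
      then show ?thesis
        using m_upper[of "t + real (card I) * \<delta>"] unfolding card by (simp add: algebra_simps)
    qed
    fix i
    assume i: "i \<in> insert k I"
      and gap: "\<forall>j\<in>insert k I - {i}. l j x + real (card (insert k I)) * \<delta> \<le> l i x"
    show "m (G x) (l k x) = l i x"
    proof (cases "i = k")
      case True
      \<comment> \<open>The gap bounds every old function by
        \<open>l k x - (card I + 1) * \<delta>\<close>; \<open>upper\<close> loses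
        \<open>card I * \<delta>\<close> of this and leaves one \<open>\<delta>\<close>.\<close>
      have "G x \<le> l k x - (real (card I) + 1) * \<delta> + real (card I) * \<delta>"
        using gap True insert.hyps unfolding card by (intro upper) force
      then have "l k x - G x \<ge> \<delta>"
        by (simp add: algebra_simps)
      then show ?thesis
        using \<phi>(6) True by (simp add: m_def)
    next
      case False
      then have "i \<in> I"
        using i by simp
      \<comment> \<open>The margin covers both the induction hypothesis and the final
        \<open>\<delta>\<close> that makes \<open>\<phi>\<close> vanish.\<close>
      have weaker: "l j x + real (card I) * \<delta> + \<delta> \<le> l i x" if "j \<in> insert k I - {i}" for j
        using gap that unfolding card by (auto simp: algebra_simps)
      have "G x = l i x"
        using weaker \<open>\<delta> > 0\<close> by (intro exact[OF \<open>i \<in> I\<close>]) force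
      moreover have "l k x - l i x \<le> - \<delta>"
      proof -
        have "l k x + real (card I) * \<delta> + \<delta> \<le> l i x"
          using weaker False by simp
        moreover have "0 \<le> real (card I) * \<delta>"
          using \<open>\<delta> > 0\<close> by simp
        ultimately show ?thesis by linarith
      qed
      ultimately show ?thesis
        using \<phi>(5) by (simp add: m_def)
    qed
  qed
qed


section \<open>Convex interpolation of values and gradients\<close>

text \<open>Each pair of a value and a gradient determines an affine function. The hypothesis makes
  the one belonging to \<open>x i\<close> the strict maximum at \<open>x i\<close>, so the smooth
  maximum with small \<open>\<delta>\<close> equals it near that point.\<close>

lemma smooth_convex_interpolation:
  fixes x g :: "'i \<Rightarrow> 'a::real_inner" and c :: "'i \<Rightarrow> real"
  assumes "finite I" "I \<noteq> {}"
    and supporting: "\<And>i j. i \<in> I \<Longrightarrow> j \<in> I \<Longrightarrow> i \<noteq> j \<Longrightarrow> c i + g i \<bullet> (x j - x i) < c j"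
  obtains G where "smooth G" "convex_on UNIV G"
    "\<And>i. i \<in> I \<Longrightarrow> G (x i) = c i" "\<And>i. i \<in> I \<Longrightarrow> GDERIV G (x i) :> g i"
proof -
  define l where "l i y = (c i - g i \<bullet> x i) + g i \<bullet> y" for i y
  have l_at: "l i (x i) = c i" for i
    by (simp add: l_def)
  have gap: "l j (x i) < l i (x i)" if "i \<in> I" "j \<in> I" "i \<noteq> j" for i j
    using supporting[of j i] that by (simp add: l_def inner_diff_right)
  have smooth: "smooth (l i)" for i
    unfolding l_def by (intro smooth_add smooth_const smooth_bounded_linear bounded_linear_inner_right)
  have convex: "convex_on UNIV (l i)" for i
    by (intro convex_onI) (auto simp: l_def algebra_simps)
  have deriv: "GDERIV (l i) y :> g i" for i y
    unfolding gderiv_def l_def by (auto intro!: derivative_eq_intros simp: inner_commute)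
  \<comment> \<open>Finitely many strict gaps admit a common positive
    \<open>\<delta>\<close>.\<close>
  have "\<forall>\<^sub>F \<delta> in at_right 0. \<forall>i\<in>I. \<forall>j\<in>I - {i}. l j (x i) + real (card I) * \<delta> < l i (x i)"
  proof (intro eventually_ball_finite ballI finite_Diff \<open>finite I\<close>)
    fix i j assume ij: "i \<in> I" "j \<in> I - {i}"
    have "((\<lambda>\<delta>. l j (x i) + real (card I) * \<delta>) \<longlongrightarrow> l j (x i) + real (card I) * 0) (at_right 0)"
      by (intro tendsto_intros)
    then show "\<forall>\<^sub>F \<delta> in at_right 0. l j (x i) + real (card I) * \<delta> < l i (x i)"
      by (rule order_tendstoD(2)) (use gap ij in auto)
  qed
  then have "\<forall>\<^sub>F \<delta> in at_right 0. \<delta> > 0 \<and>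
      (\<forall>i\<in>I. \<forall>j\<in>I - {i}. l j (x i) + real (card I) * \<delta> < l i (x i))"
    using eventually_at_right_less[of 0] by eventually_elim auto
  from eventually_happens'[OF trivial_limit_at_right_real this]
  obtain \<delta> where \<delta>: "\<delta> > 0"
    and margin: "\<forall>i\<in>I. \<forall>j\<in>I - {i}. l j (x i) + real (card I) * \<delta> < l i (x i)"
    by (elim exE conjE)
  obtain G where G: "smooth G" "convex_on UNIV G"
    and exact: "\<And>y i. i \<in> I \<Longrightarrow> \<forall>j\<in>I - {i}. l j y + real (card I) * \<delta> \<le> l i y \<Longrightarrow> G y = l i y"
    using smooth_convex_max[OF \<delta> \<open>finite I\<close> \<open>I \<noteq> {}\<close>, of l] smooth convex by blast
  show thesis
  proof (rule that[OF G])
    fix i assume "i \<in> I"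
    have cont: "isCont (l j) y" for j y
      using deriv[of j y] unfolding gderiv_def by (rule has_derivative_continuous)
    \<comment> \<open>Strict gaps persist nearby by continuity. Equality on a neighbourhood, not
      only at \<open>x i\<close>, is what transfers the gradient.\<close>
    have "\<forall>\<^sub>F y in nhds (x i). \<forall>j\<in>I - {i}. l j y + real (card I) * \<delta> < l i y"
    proof (intro eventually_ball_finite ballI finite_Diff \<open>finite I\<close>)
      fix j assume j: "j \<in> I - {i}"
      have "isCont (\<lambda>y. l i y - (l j y + real (card I) * \<delta>)) (x i)"
        by (intro continuous_intros cont)
      then have "((\<lambda>y. l i y - (l j y + real (card I) * \<delta>)) \<longlongrightarrow>
          l i (x i) - (l j (x i) + real (card I) * \<delta>)) (nhds (x i))"
        unfolding continuous_at using tendsto_at_iff_tendsto_nhds by blast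
      then have "\<forall>\<^sub>F y in nhds (x i). 0 < l i y - (l j y + real (card I) * \<delta>)"
        by (rule order_tendstoD(1)) (use margin \<open>i \<in> I\<close> j in simp)
      then show "\<forall>\<^sub>F y in nhds (x i). l j y + real (card I) * \<delta> < l i y"
        by eventually_elim simp
    qed
    then have ev: "\<forall>\<^sub>F y in nhds (x i). l i y = G y"
      by eventually_elim (use exact[OF \<open>i \<in> I\<close>] in \<open>force intro: less_imp_le\<close>)
    show "G (x i) = c i"
      using eventually_nhds_x_imp_x[OF ev] l_at by simp
    have "(l i has_derivative (\<lambda>h. h \<bullet> g i)) (at (x i))"
      using deriv by (simp add: gderiv_def)
    then have "(G has_derivative (\<lambda>h. h \<bullet> g i)) (at (x i))"
      by (rule has_derivative_transform_eventually)
        (use ev eventually_nhds_x_imp_x[OF ev] in \<open>auto simp: eventually_at_filter elim: eventually_mono\<close>)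
    then show "GDERIV G (x i) :> g i"
      by (simp add: gderiv_def)
  qed
qed


section \<open>Gradients and subdeterminants\<close>

text \<open>As \<open>grad\<close> is a definite description, uniqueness is required: vectors with
  equal inner products against all \<open>h\<close> coincide.\<close>

lemma grad_eqI:
  assumes "GDERIV f x :> D"
  shows "grad f x = D"
  unfolding grad_def
proof (rule the_equality)
  show "GDERIV f x :> D" by (fact assms)
  fix E assume "GDERIV f x :> E"
  with assms have "(\<lambda>h. h \<bullet> E) = (\<lambda>h. h \<bullet> D)"
    unfolding gderiv_def by (rule has_derivative_unique[rotated])
  then show "E = D"
    by (metis inner_commute vector_eq_rdot)
qed

text \<open>Riesz representation of the derivative in an orthonormal basis.\<close>

lemma GDERIV_if_has_derivative:
  fixes f :: "'a::euclidean_space \<Rightarrow> real"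
  assumes "(f has_derivative f') (at x)"
  shows "GDERIV f x :> (\<Sum>b\<in>Basis. f' b *\<^sub>R b)"
proof -
  have "linear f'"
    by (rule has_derivative_linear[OF assms])
  then have "f' h = h \<bullet> (\<Sum>b\<in>Basis. f' b *\<^sub>R b)" for h
    using linear_sum[of f' "\<lambda>b. (h \<bullet> b) *\<^sub>R b" Basis]
    by (simp add: euclidean_representation linear_scale inner_sum_right mult.commute)
  then show ?thesis
    unfolding gderiv_def by (intro has_derivative_eq_rhs[OF assms] ext)
qed

lemma GDERIV_partial:
  fixes G :: "'a::real_inner \<times> 'b::real_inner \<Rightarrow> real"
  assumes "GDERIV G (a, w) :> (D, E)"
  shows "GDERIV (\<lambda>a. G (a, w)) a :> D" and "GDERIV (\<lambda>w. G (a, w)) w :> E"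
proof -
  have G: "(G has_derivative (\<lambda>h. h \<bullet> (D, E))) (at (a, w))"
    using assms by (simp add: gderiv_def)
  have "((\<lambda>a. (a, w)) has_derivative (\<lambda>h. (h, 0))) (at a)"
    by (intro derivative_intros)
  from has_derivative_compose[OF this G] show "GDERIV (\<lambda>a. G (a, w)) a :> D"
    by (simp add: gderiv_def)
  have "((\<lambda>w. (a, w)) has_derivative (\<lambda>h. (0, h))) (at w)"
    by (intro derivative_intros)
  from has_derivative_compose[OF this G] show "GDERIV (\<lambda>w. G (a, w)) w :> E"
    by (simp add: gderiv_def)
qed

text \<open>The symmetric bilinear form that polarises the quadratic map \<open>J\<close>; fixing
  \<open>A\<close> gives the derivative of \<open>J\<close> at \<open>A\<close>.\<close>

definition J_polar ::
    "('d \<Rightarrow> 'n \<times> 'n) \<Rightarrow> real ^ 'n::finite ^ 2 \<Rightarrow> real ^ 'n ^ 2 \<Rightarrow> real ^ 'd::finite" where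
  "J_polar pr A H = (\<chi> m. A $ 1 $ fst (pr m) * H $ 2 $ snd (pr m)
     + H $ 1 $ fst (pr m) * A $ 2 $ snd (pr m)
     - A $ 1 $ snd (pr m) * H $ 2 $ fst (pr m)
     - H $ 1 $ snd (pr m) * A $ 2 $ fst (pr m))"

lemma J_nth:
  "J pr A $ m = A $ 1 $ fst (pr m) * A $ 2 $ snd (pr m) - A $ 1 $ snd (pr m) * A $ 2 $ fst (pr m)"
  by (simp add: J_def det_2)

text \<open>Taylor's formula for \<open>J\<close>, exact at second order because \<open>J\<close> is
  quadratic.\<close>

lemma J_expansion: "J pr B = J pr A + J_polar pr A (B - A) + J pr (B - A)"
  by (simp add: Finite_Cartesian_Product.vec_eq_iff J_nth J_polar_def algebra_simps)

lemma J_has_derivative: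
  fixes pr :: "'d::finite \<Rightarrow> 'n::finite \<times> 'n"
  shows "(J pr has_derivative J_polar pr A) (at A)"
proof (subst has_derivative_componentwise_within, rule ballI)
  fix b :: "real ^ 'd" assume "b \<in> Basis"
  then obtain m where m: "b = axis m 1"
    by (auto simp: Basis_vec_def)
  have entry: "((\<lambda>B :: real ^ 'n ^ 2. B $ i $ j) has_derivative (\<lambda>H. H $ i $ j)) (at A)" for i j
    by (intro bounded_linear_imp_has_derivative
        bounded_linear_compose[OF bounded_linear_vec_nth bounded_linear_vec_nth])
  show "((\<lambda>B. J pr B \<bullet> b) has_derivative (\<lambda>H. J_polar pr A H \<bullet> b)) (at A)"
    unfolding m
    by (auto simp: inner_axis J_nth J_polar_def intro!: derivative_eq_intros entry)
qed

text \<open>The gradient named by \<open>dot_DJ\<close> exists by Riesz representation; uniqueness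
  of derivatives then identifies it through \<open>J_polar\<close>.\<close>

lemma inner_J_GDERIV: "GDERIV (\<lambda>A. v \<bullet> J pr A) A :> dot_DJ pr v A"
  and inner_dot_DJ: "H \<bullet> dot_DJ pr v A = v \<bullet> J_polar pr A H"
proof -
  have D: "((\<lambda>A. v \<bullet> J pr A) has_derivative (\<lambda>H. v \<bullet> J_polar pr A H)) (at A)"
    by (intro has_derivative_inner_right J_has_derivative)
  show G: "GDERIV (\<lambda>A. v \<bullet> J pr A) A :> dot_DJ pr v A"
    unfolding dot_DJ_def grad_eqI[OF GDERIV_if_has_derivative[OF D]]
    by (rule GDERIV_if_has_derivative[OF D])
  show "H \<bullet> dot_DJ pr v A = v \<bullet> J_polar pr A H"
    using fun_cong[OF has_derivative_unique[OF G[unfolded gderiv_def] D]] .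
qed

text \<open>The chain rule along the lift of \<open>A\<close> to \<open>(A, J pr A)\<close>. The
  prescribed \<open>D\<close> will cancel the first and last summands up to the target
  gradient.\<close>

lemma F0_GDERIV:
  assumes "GDERIV G (A, J pr A) :> (D, v)"
  shows "GDERIV (F0 pr \<epsilon> G) A :> \<epsilon> *\<^sub>R A + D + dot_DJ pr v A"
proof -
  have "((\<lambda>A. (A, J pr A)) has_derivative (\<lambda>H. (H, J_polar pr A H))) (at A)"
    by (rule has_derivative_Pair[OF has_derivative_ident J_has_derivative])
  from has_derivative_compose[OF this assms[unfolded gderiv_def]]
  have "((\<lambda>A. G (A, J pr A)) has_derivative (\<lambda>H. H \<bullet> D + J_polar pr A H \<bullet> v)) (at A)"
    by simp
  then have "((\<lambda>A. \<epsilon> / 2 * (A \<bullet> A) + G (A, J pr A)) has_derivative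
      (\<lambda>H. H \<bullet> (\<epsilon> *\<^sub>R A + D + dot_DJ pr v A))) (at A)"
    by (rule has_derivative_eq_rhs[OF has_derivative_add[OF has_derivative_mult_right[OF
            has_derivative_inner[OF has_derivative_ident has_derivative_ident]]]])
      (simp add: fun_eq_iff inner_add_right inner_dot_DJ inner_commute[of A]
        inner_commute[of "J_polar pr A _"])
  then show ?thesis
    by (simp add: gderiv_def F0_def[abs_def] power2_norm_eq_inner)
qed

text \<open>The linear part of \<open>J pr A' - J pr A\<close> cancels the \<open>dot_DJ\<close>
  correction, leaving the expression of the hypothesis and a term of order
  \<open>\<epsilon>\<close>.\<close>

lemma inner_lifted_difference:
  "(B - \<epsilon> *\<^sub>R A - dot_DJ pr v A, v) \<bullet> ((A', J pr A') - (A, J pr A)) =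
    B \<bullet> (A' - A) + v \<bullet> J pr (A' - A) - \<epsilon> * (A \<bullet> (A' - A))"
proof -
  have "v \<bullet> (J pr A' - J pr A) = (A' - A) \<bullet> dot_DJ pr v A + v \<bullet> J pr (A' - A)"
    using J_expansion[of pr A' A] by (simp add: inner_dot_DJ inner_add_right)
  moreover have "(B - \<epsilon> *\<^sub>R A - dot_DJ pr v A) \<bullet> (A' - A) =
      B \<bullet> (A' - A) - \<epsilon> * (A \<bullet> (A' - A)) - (A' - A) \<bullet> dot_DJ pr v A"
    by (simp only: inner_diff_left inner_scaleR_left inner_commute[of _ "dot_DJ pr v A"])
  ultimately show ?thesis
    by simp
qed

section \<open>Interpolation at the lifted points\<close>

theorem proposition4p4:
  fixes pos :: "'n::finite \<Rightarrow> nat" and pr :: "'d::finite \<Rightarrow> 'n \<times> 'n"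
    and n N :: nat
    and c :: "nat \<Rightarrow> real" and d :: "nat \<Rightarrow> real ^ 'd" and U\<^sub>0 :: params
  assumes "n = CARD('n)" and "n \<ge> 2" and "N = 2 * n + 1" and "CARD('d) = n * (n - 1) div 2"
    and "bij_betw pos UNIV {1..n}"
    and "bij_betw pr UNIV {(j, k). pos j < pos k}"
    and "U\<^sub>0 \<in> U_set pos"
    and "\<And>i j. i \<in> {1..N} \<Longrightarrow> j \<in> {1..N} \<Longrightarrow> i \<noteq> j \<Longrightarrow>
           c j - c i > eta2 pos U\<^sub>0 i \<bullet> (eta1 pos U\<^sub>0 j - eta1 pos U\<^sub>0 i)
                       + d i \<bullet> J pr (eta1 pos U\<^sub>0 j - eta1 pos U\<^sub>0 i)"
  shows "\<exists>\<epsilon>\<^sub>0>0. \<forall>\<epsilon>\<in>{0<..<\<epsilon>\<^sub>0}. \<exists>G :: (real ^ 'n ^ 2) \<times> (real ^ 'd) \<Rightarrow> real.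
           smooth G \<and> convex_on UNIV G \<and>
           (\<forall>i\<in>{1..N}.
              G (eta1 pos U\<^sub>0 i, J pr (eta1 pos U\<^sub>0 i)) = c i \<and>
              grad (\<lambda>w. G (eta1 pos U\<^sub>0 i, w)) (J pr (eta1 pos U\<^sub>0 i)) = d i \<and>
              grad (\<lambda>A. G (A, J pr (eta1 pos U\<^sub>0 i))) (eta1 pos U\<^sub>0 i)
                = eta2 pos U\<^sub>0 i - \<epsilon> *\<^sub>R eta1 pos U\<^sub>0 i - dot_DJ pr (d i) (eta1 pos U\<^sub>0 i)) \<and>
           (\<forall>i\<in>{1..N}. eta pos U\<^sub>0 i \<in> K_set (F0 pr \<epsilon> G)) \<and>
           (\<forall>i\<in>{1..N}. \<forall>j\<in>{1..N}. i \<noteq> j \<longrightarrow> eta1 pos U\<^sub>0 i \<noteq> eta1 pos U\<^sub>0 j)"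
proof -
  let ?A = "eta1 pos U\<^sub>0" and ?B = "eta2 pos U\<^sub>0"
  let ?x = "\<lambda>i. (?A i, J pr (?A i))"
  let ?g = "\<lambda>\<epsilon> i. (?B i - \<epsilon> *\<^sub>R ?A i - dot_DJ pr (d i) (?A i), d i)"
  have gap_at: "c i + ?g \<epsilon> i \<bullet> (?x j - ?x i) =
      c i + (?B i \<bullet> (?A j - ?A i) + d i \<bullet> J pr (?A j - ?A i)) - \<epsilon> * (?A i \<bullet> (?A j - ?A i))" for \<epsilon> i j
    using inner_lifted_difference[of "?B i" \<epsilon> "?A i" pr "d i" "?A j"] by linarith
  \<comment> \<open>At \<open>\<epsilon> = 0\<close> this is the hypothesis; strictness and
    finiteness extend it to all small positive \<open>\<epsilon>\<close>.\<close>
  have "\<forall>\<^sub>F \<epsilon> in at_right 0. \<forall>i\<in>{1..N}. \<forall>j\<in>{1..N} - {i}.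
      c i + ?g \<epsilon> i \<bullet> (?x j - ?x i) < c j"
  proof (intro eventually_ball_finite ballI finite_Diff finite_atLeastAtMost)
    fix i j assume ij: "i \<in> {1..N}" "j \<in> {1..N} - {i}"
    let ?h = "\<lambda>\<epsilon>. c i + (?B i \<bullet> (?A j - ?A i) + d i \<bullet> J pr (?A j - ?A i))
      - \<epsilon> * (?A i \<bullet> (?A j - ?A i))"
    have "(?h \<longlongrightarrow> ?h 0) (at_right 0)"
      by (intro tendsto_intros)
    then have "\<forall>\<^sub>F \<epsilon> in at_right 0. ?h \<epsilon> < c j"
      by (rule order_tendstoD(2)) (use assms(8)[of i j] ij in auto)
    then show "\<forall>\<^sub>F \<epsilon> in at_right 0. c i + ?g \<epsilon> i \<bullet> (?x j - ?x i) < c j"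
      by (simp only: gap_at)
  qed
  then obtain \<epsilon>\<^sub>0 where \<epsilon>\<^sub>0: "\<epsilon>\<^sub>0 > 0"
    and gap: "\<And>\<epsilon> i j. 0 < \<epsilon> \<Longrightarrow> \<epsilon> < \<epsilon>\<^sub>0 \<Longrightarrow> i \<in> {1..N} \<Longrightarrow> j \<in> {1..N} - {i} \<Longrightarrow>
      c i + ?g \<epsilon> i \<bullet> (?x j - ?x i) < c j"
    unfolding eventually_at_right_field by blast
  \<comment> \<open>If \<open>\<eta>\<^sub>i\<^sup>1 = \<eta>\<^sub>j\<^sup>1\<close>, the hypothesis for \<open>(i, j)\<close> and \<open>(j, i)\<close> gives \<open>c\<^sub>i < c\<^sub>j < c\<^sub>i\<close>.\<close>
  have distinct: "?A i \<noteq> ?A j" if "i \<in> {1..N}" "j \<in> {1..N}" "i \<noteq> j" for i j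
  proof
    assume eq: "?A i = ?A j"
    have "J pr (0 :: real ^ 'n ^ 2) = 0"
      by (simp add: Finite_Cartesian_Product.vec_eq_iff J_nth)
    then show False
      using assms(8)[OF that] assms(8)[OF that(2,1)] that(3) eq by simp
  qed
  show ?thesis
  proof (intro exI[of _ \<epsilon>\<^sub>0] conjI \<epsilon>\<^sub>0 ballI)
    fix \<epsilon> assume "\<epsilon> \<in> {0<..<\<epsilon>\<^sub>0}"
    then have \<epsilon>: "0 < \<epsilon>" "\<epsilon> < \<epsilon>\<^sub>0"
      by auto
    have "{1..N} \<noteq> {}"
      using \<open>N = 2 * n + 1\<close> by simp
    then obtain G where G: "smooth G" "convex_on UNIV G" "\<And>i. i \<in> {1..N} \<Longrightarrow> G (?x i) = c i"
      and deriv: "\<And>i. i \<in> {1..N} \<Longrightarrow> GDERIV G (?x i) :> ?g \<epsilon> i"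
      using smooth_convex_interpolation[of "{1..N}" c "?g \<epsilon>" ?x] gap[OF \<epsilon>] by auto
    have "eta pos U\<^sub>0 i \<in> K_set (F0 pr \<epsilon> G)" if "i \<in> {1..N}" for i
    proof -
      \<comment> \<open>The \<open>\<epsilon>\<close> and \<open>dot_DJ\<close> terms of
        \<open>F0_GDERIV\<close> cancel those subtracted in \<open>?g \<epsilon> i\<close>.\<close>
      have "grad (F0 pr \<epsilon> G) (?A i) = ?B i"
        using grad_eqI[OF F0_GDERIV[OF deriv[OF that]], of \<epsilon>] by simp
      then show ?thesis
        unfolding K_set_def by (auto intro!: exI[of _ "?A i"] simp: prod_eq_iff)
    qed
    then show "\<exists>G :: (real ^ 'n ^ 2) \<times> (real ^ 'd) \<Rightarrow> real.
           smooth G \<and> convex_on UNIV G \<and>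
           (\<forall>i\<in>{1..N}.
              G (?x i) = c i \<and>
              grad (\<lambda>w. G (?A i, w)) (J pr (?A i)) = d i \<and>
              grad (\<lambda>A. G (A, J pr (?A i))) (?A i)
                = ?B i - \<epsilon> *\<^sub>R ?A i - dot_DJ pr (d i) (?A i)) \<and>
           (\<forall>i\<in>{1..N}. eta pos U\<^sub>0 i \<in> K_set (F0 pr \<epsilon> G)) \<and>
           (\<forall>i\<in>{1..N}. \<forall>j\<in>{1..N}. i \<noteq> j \<longrightarrow> ?A i \<noteq> ?A j)"
      using G distinct grad_eqI[OF GDERIV_partial(1)[OF deriv]] grad_eqI[OF GDERIV_partial(2)[OF deriv]]
      by (intro exI[of _ G]) blast
  qed
qed

end
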